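(* Let $a,b>0$, fix $\tau\in(0,1)$, and let $t\in(0,1)$. If $t\leq r(\tau)$ or $t\geq R(\tau)$, then $$\frac{a\nabla b-!_{\tau}(a,b)}{\tau(1-\tau)}\leq \frac{a\nabla b-!_{t}(a,b)}{t(1-t)}.$$ If instead $r(\tau)\leq t\leq R(\tau)$, then the reversed inequality holds: $$\frac{a\nabla b-!_{\tau}(a,b)}{\tau(1-\tau)}\geq \frac{a\nabla b-!_{t}(a,b)}{t(1-t)}.$$
   Context: For $a,b>0$ and $0\le t\le 1$: $a!_t b=((1-t)a^{-1}+tb^{-1})^{-1}$ is the weighted harmonic mean, $a\nabla b=\frac{a+b}{2}$, and the harmonic Heinz mean is $!_t(a,b)=\frac{a!_tb+a!_{1-t}b}{2}$. For $0\le\tau\le1$, $r(\tau)=\min\{\tau,1-\tau\}$ and $R(\tau)=\max\{\tau,1-\tau\}$. *)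

theory Defs
  imports Complex_Main
begin

text \<open>
  The means below are only meaningful for \<open>a, b > 0\<close> and \<open>0 \<le> t \<le> 1\<close>;
  \<open>harm_mean t a b\<close> is written \<open>a !\<^sub>t b\<close> on paper, and the weight \<open>t\<close> belongs to \<open>b\<close>.
\<close>

definition harm_mean :: "real \<Rightarrow> real \<Rightarrow> real \<Rightarrow> real" where
  "harm_mean t a b = inverse ((1 - t) * inverse a + t * inverse b)"

definition arith_mean :: "real \<Rightarrow> real \<Rightarrow> real" where
  "arith_mean a b = (a + b) / 2"

definition harm_heinz :: "real \<Rightarrow> real \<Rightarrow> real \<Rightarrow> real" where
  "harm_heinz t a b = (harm_mean t a b + harm_mean (1 - t) a b) / 2"

definition r_min :: "real \<Rightarrow> real" where
  "r_min \<tau> = min \<tau> (1 - \<tau>)"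

definition R_max :: "real \<Rightarrow> real" where
  "R_max \<tau> = max \<tau> (1 - \<tau>)"

end

theory Submission
  imports Defs
begin

text \<open>
  The quotient depends on \<open>t\<close> only through \<open>s = t * (1 - t)\<close>. Indeed \<open>harm_mean t a b\<close> is
  \<open>a * b\<close> divided by \<open>P = (1 - t) * b + t * a\<close>, and exchanging \<open>t\<close> with \<open>1 - t\<close> replaces \<open>P\<close> by
  \<open>Q = t * b + (1 - t) * a\<close>. Here \<open>P + Q = a + b\<close> is independent of \<open>t\<close>, while
  \<open>P * Q = a * b + s * (a - b)\<^sup>2\<close>. The difference between the arithmetic mean and the Heinz mean
  therefore contains the factor \<open>s\<close>, and dividing it out leaves
  \<open>(a + b) * (a - b)\<^sup>2 / (2 * (a * b + s * (a - b)\<^sup>2))\<close>, which is antitone in \<open>s\<close>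
  (\<open>heinz_gap_quotient\<close>, \<open>heinz_gap_quotient_antimono\<close>).
  Since \<open>s\<close> is symmetric about \<open>1/2\<close> and peaks there, the value of \<open>s\<close> at \<open>t\<close> is smaller
  than at \<open>\<tau>\<close> exactly when \<open>t\<close> lies outside the closed interval with endpoints \<open>\<tau>\<close> and \<open>1 - \<tau>\<close>.
\<close>

lemma harm_mean_eq_divide:
  assumes "a > 0" "b > 0"
  shows "harm_mean t a b = a * b / ((1 - t) * b + t * a)"
proof -
  have "(1 - t) * inverse a + t * inverse b = ((1 - t) * b + t * a) / (a * b)"
    using assms by (simp add: field_simps)
  then show ?thesis
    unfolding harm_mean_def by simp
qed

lemma harm_heinz_eq_divide:
  assumes "a > 0" "b > 0" "0 \<le> t" "t \<le> 1"
  shows "harm_heinz t a b = a * b * (a + b) / (2 * (a * b + t * (1 - t) * (a - b)\<^sup>2))"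
proof -
  define P where "P = (1 - t) * b + t * a"
  define Q where "Q = t * b + (1 - t) * a"
  have "P > 0"
    using assms unfolding P_def by (cases "t = 0") (auto intro!: add_nonneg_pos)
  moreover have "Q > 0"
    using assms unfolding Q_def by (cases "t = 0") (auto intro!: add_pos_nonneg)
  moreover have "harm_heinz t a b = (a * b / P + a * b / Q) / 2"
    using assms by (simp add: harm_heinz_def harm_mean_eq_divide P_def Q_def)
  ultimately have "harm_heinz t a b = a * b * (P + Q) / (2 * (P * Q))"
    by (simp add: field_simps)
  moreover have "P + Q = a + b"
    unfolding P_def Q_def by algebra
  moreover have "P * Q = a * b + t * (1 - t) * (a - b)\<^sup>2"
    unfolding P_def Q_def by algebra
  ultimately show ?thesis
    by simp
qed

lemma heinz_gap_quotient:
  assumes "a > 0" "b > 0" "0 < t" "t < 1"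
  shows "(arith_mean a b - harm_heinz t a b) / (t * (1 - t))
       = (a + b) * (a - b)\<^sup>2 / (2 * (a * b + t * (1 - t) * (a - b)\<^sup>2))"
proof -
  define s where "s = t * (1 - t)"
  define D where "D = a * b + s * (a - b)\<^sup>2"
  have "s > 0"
    using assms by (simp add: s_def)
  then have "D > 0"
    using assms by (simp add: D_def add_pos_nonneg)
  have "arith_mean a b - harm_heinz t a b = (a + b) / 2 - a * b * (a + b) / (2 * D)"
    using assms by (simp add: arith_mean_def harm_heinz_eq_divide D_def s_def)
  also have "\<dots> = (a + b) * (D - a * b) / (2 * D)"
    using \<open>D > 0\<close> by (simp add: field_simps)
  also have "\<dots> = s * ((a + b) * (a - b)\<^sup>2 / (2 * D))"
    by (simp add: D_def)
  finally show ?thesis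
    using \<open>s > 0\<close> by (simp add: D_def flip: s_def)
qed

lemma heinz_gap_quotient_antimono:
  assumes "a > 0" "b > 0" "0 < t" "t < 1" "0 < u" "u < 1"
    and "t * (1 - t) \<le> u * (1 - u)"
  shows "(arith_mean a b - harm_heinz u a b) / (u * (1 - u))
       \<le> (arith_mean a b - harm_heinz t a b) / (t * (1 - t))"
  unfolding heinz_gap_quotient[OF assms(1-4)] heinz_gap_quotient[OF assms(1,2,5,6)]
proof (rule divide_left_mono)
  have pos: "a * b + v * (1 - v) * (a - b)\<^sup>2 > 0" if "0 < v" "v < 1" for v
    using that assms by (simp add: add_pos_nonneg)
  show "0 < 2 * (a * b + u * (1 - u) * (a - b)\<^sup>2) * (2 * (a * b + t * (1 - t) * (a - b)\<^sup>2))"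
    using pos[of u] pos[of t] assms(3-6) by (intro mult_pos_pos zero_less_numeral)
  show "2 * (a * b + t * (1 - t) * (a - b)\<^sup>2) \<le> 2 * (a * b + u * (1 - u) * (a - b)\<^sup>2)"
    using assms(7) by (simp add: mult_right_mono)
  show "0 \<le> (a + b) * (a - b)\<^sup>2"
    using assms by simp
qed

text \<open>
  Both comparisons of \<open>t * (1 - t)\<close> with \<open>\<tau> * (1 - \<tau>)\<close> are read off from this factorization:
  its roots in \<open>t\<close> are \<open>\<tau>\<close> and \<open>1 - \<tau>\<close>, that is, \<open>r_min \<tau>\<close> and \<open>R_max \<tau>\<close>.
\<close>

lemma weight_product_diff:
  "\<tau> * (1 - \<tau>) - t * (1 - t) = (t - r_min \<tau>) * (t - R_max \<tau>)"
  by (simp add: r_min_def R_max_def min_def max_def algebra_simps)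

lemma r_min_le_R_max: "r_min \<tau> \<le> R_max \<tau>"
  by (simp add: r_min_def R_max_def)

theorem corollary2p3:
  fixes a b \<tau> t :: real
  assumes "a > 0" and "b > 0"
    and "0 < \<tau>" and "\<tau> < 1"
    and "0 < t" and "t < 1"
  shows "(t \<le> r_min \<tau> \<or> t \<ge> R_max \<tau> \<longrightarrow>
            (arith_mean a b - harm_heinz \<tau> a b) / (\<tau> * (1 - \<tau>))
              \<le> (arith_mean a b - harm_heinz t a b) / (t * (1 - t)))
       \<and> (r_min \<tau> \<le> t \<and> t \<le> R_max \<tau> \<longrightarrow>
            (arith_mean a b - harm_heinz \<tau> a b) / (\<tau> * (1 - \<tau>))
              \<ge> (arith_mean a b - harm_heinz t a b) / (t * (1 - t)))"
proof (intro conjI impI)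
  assume "t \<le> r_min \<tau> \<or> t \<ge> R_max \<tau>"
  then have "0 \<le> (t - r_min \<tau>) * (t - R_max \<tau>)"
    using r_min_le_R_max[of \<tau>] by (auto simp: zero_le_mult_iff)
  then have "t * (1 - t) \<le> \<tau> * (1 - \<tau>)"
    using weight_product_diff[of \<tau> t] by linarith
  then show "(arith_mean a b - harm_heinz \<tau> a b) / (\<tau> * (1 - \<tau>))
              \<le> (arith_mean a b - harm_heinz t a b) / (t * (1 - t))"
    using assms by (intro heinz_gap_quotient_antimono)
next
  assume "r_min \<tau> \<le> t \<and> t \<le> R_max \<tau>"
  then have "(t - r_min \<tau>) * (t - R_max \<tau>) \<le> 0"
    by (simp add: mult_nonneg_nonpos)
  then have "\<tau> * (1 - \<tau>) \<le> t * (1 - t)"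
    using weight_product_diff[of \<tau> t] by linarith
  then show "(arith_mean a b - harm_heinz \<tau> a b) / (\<tau> * (1 - \<tau>))
              \<ge> (arith_mean a b - harm_heinz t a b) / (t * (1 - t))"
    using assms by (intro heinz_gap_quotient_antimono)
qed

end
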